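(* Let $\mathtt{TWIN}=\{wcw\mid w\in\{a,b\}^*\}$ over the alphabet $\{a,b,c\}$. Then $\mathtt{TWIN}\in\mathsf{oneway\mbox{-}IP}(\mathrm{cons\mbox{-}space},\mathrm{cons\mbox{-}random\mbox{-}bits},\mathrm{rt\mbox{-}input})$.
   Context: A verifier is a probabilistic Turing machine with a read-only input tape (input between two end-markers), one read/write work tape, fair random bits, and a certificate (the one-way prover's message sequence, which depends only on the input) read by a head that never moves left (but may stay put). A (strong) one-way interactive proof system with error $\varepsilon$ for $L$: some certificate makes every $x\in L$ accepted with probability $\ge1-\varepsilon$, and for $x\notin L$ every certificate leads to rejection with probability $\ge1-\varepsilon$. $\mathsf{oneway\mbox{-}IP}(\cdot)$ is the class of languages with such systems with some $\varepsilon<\frac12$ whose verifier satisfies: cons-space = $O(1)$ work-tape cells; cons-random-bits = number of coin tosses bounded by a constant independent of the input; rt-input = the input head moves right at every step (real-time). *)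

theory Defs
  imports "HOL-Probability.Probability"
begin

datatype 'a tape_symbol = Left_End | Letter 'a | Right_End

datatype direction = Leftwards | Stay | Rightwards

fun move :: "direction \<Rightarrow> int \<Rightarrow> int" where
  "move Leftwards p = p - 1"
| "move Stay p = p"
| "move Rightwards p = p + 1"

text \<open>
  States, work symbols and certificate symbols are drawn from finite sets of natural numbers,
  so that one can quantify over all verifiers. The transition function receives the state, the
  symbols scanned on the input, work and certificate tapes, and the outcome of the coin toss,
  which is \<open>None\<close> exactly in the states that toss no coin. It returns the new state,
  the work symbol written, the moves of the input head and of the work head, and whether the
  certificate head advances by one cell (otherwise it stays put).
\<close>

record 'a verifier =
  states :: "nat set"
  tossing_states :: "nat set"
  start_state :: nat
  accept_state :: nat
  reject_state :: nat
  work_alphabet :: "nat set"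
  blank_symbol :: nat
  cert_alphabet :: "nat set"
  transition :: "nat \<Rightarrow> 'a tape_symbol \<Rightarrow> nat \<Rightarrow> nat \<Rightarrow> bool option
    \<Rightarrow> nat \<times> nat \<times> direction \<times> direction \<times> bool"

definition halting_states :: "'a verifier \<Rightarrow> nat set" where
  "halting_states V = {accept_state V, reject_state V}"

text \<open>
  The input head never leaves the input between the two end-markers, except that the very last
  step of a computation, which enters a halting state, may move it off the right end-marker.
  This lets a verifier whose input head moves right at every step still read the right
  end-marker.
\<close>

definition verifier :: "'a::finite verifier \<Rightarrow> bool" where
  "verifier V \<longleftrightarrow>
     finite (states V) \<and> finite (work_alphabet V) \<and> finite (cert_alphabet V) \<and>
     start_state V \<in> states V \<and> accept_state V \<in> states V \<and> reject_state V \<in> states V \<and>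
     accept_state V \<noteq> reject_state V \<and>
     tossing_states V \<subseteq> states V - halting_states V \<and>
     blank_symbol V \<in> work_alphabet V \<and> cert_alphabet V \<noteq> {} \<and>
     (\<forall>q \<in> states V - halting_states V. \<forall>s. \<forall>u \<in> work_alphabet V. \<forall>m \<in> cert_alphabet V.
        \<forall>r. (r \<noteq> None \<longleftrightarrow> q \<in> tossing_states V) \<longrightarrow>
          (case transition V q s u m r of (q', u', d, e, adv) \<Rightarrow>
             q' \<in> states V \<and> u' \<in> work_alphabet V \<and>
             (s = Left_End \<longrightarrow> d \<noteq> Leftwards) \<and>
             (s = Right_End \<and> d = Rightwards \<longrightarrow> q' \<in> halting_states V)))"

record config =
  state :: nat
  input_pos :: int
  work_tape :: "int \<Rightarrow> nat"
  work_pos :: int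
  cert_pos :: nat
  tosses :: nat

text \<open>The left end-marker is at position \<open>0\<close>.\<close>

definition scanned_input :: "'a list \<Rightarrow> int \<Rightarrow> 'a tape_symbol" where
  "scanned_input x p =
     (if p \<le> 0 then Left_End
      else if p \<le> int (length x) then Letter (x ! nat (p - 1))
      else Right_End)"

definition init_config :: "'a verifier \<Rightarrow> config" where
  "init_config V =
     \<lparr>state = start_state V, input_pos = 0, work_tape = (\<lambda>_. blank_symbol V), work_pos = 0,
      cert_pos = 0, tosses = 0\<rparr>"

text \<open>
  The random bits are supplied as an infinite sequence \<open>\<omega>\<close>, whose next unused bit is consumed
  whenever a coin is tossed. A certificate \<open>y\<close> is likewise an infinite message sequence.
\<close>

definition step ::
    "'a verifier \<Rightarrow> 'a list \<Rightarrow> (nat \<Rightarrow> nat) \<Rightarrow> (nat \<Rightarrow> bool) \<Rightarrow> config \<Rightarrow> config" where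
  "step V x y \<omega> c =
     (if state c \<in> halting_states V then c
      else
        let toss = (state c \<in> tossing_states V);
            (q', u', d, e, adv) =
              transition V (state c) (scanned_input x (input_pos c))
                (work_tape c (work_pos c)) (y (cert_pos c))
                (if toss then Some (\<omega> (tosses c)) else None)
        in \<lparr>state = q',
            input_pos = move d (input_pos c),
            work_tape = (work_tape c)(work_pos c := u'),
            work_pos = move e (work_pos c),
            cert_pos = (if adv then Suc (cert_pos c) else cert_pos c),
            tosses = (if toss then Suc (tosses c) else tosses c)\<rparr>)"

definition run ::
    "'a verifier \<Rightarrow> 'a list \<Rightarrow> (nat \<Rightarrow> nat) \<Rightarrow> (nat \<Rightarrow> bool) \<Rightarrow> nat \<Rightarrow> config" where
  "run V x y \<omega> t = (step V x y \<omega> ^^ t) (init_config V)"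

definition certificates :: "'a verifier \<Rightarrow> (nat \<Rightarrow> nat) set" where
  "certificates V = {y. range y \<subseteq> cert_alphabet V}"

definition coin_measure :: "(nat \<Rightarrow> bool) measure" where
  "coin_measure = (\<Pi>\<^sub>M i\<in>UNIV. measure_pmf (bernoulli_pmf (1/2)))"

definition accept_prob :: "'a verifier \<Rightarrow> 'a list \<Rightarrow> (nat \<Rightarrow> nat) \<Rightarrow> real" where
  "accept_prob V x y = \<P>(\<omega> in coin_measure. \<exists>t. state (run V x y \<omega> t) = accept_state V)"

definition reject_prob :: "'a verifier \<Rightarrow> 'a list \<Rightarrow> (nat \<Rightarrow> nat) \<Rightarrow> real" where
  "reject_prob V x y = \<P>(\<omega> in coin_measure. \<exists>t. state (run V x y \<omega> t) = reject_state V)"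

definition oneway_proof_system :: "'a verifier \<Rightarrow> real \<Rightarrow> 'a list set \<Rightarrow> bool" where
  "oneway_proof_system V \<epsilon> L \<longleftrightarrow>
     (\<forall>x \<in> L. \<exists>y \<in> certificates V. accept_prob V x y \<ge> 1 - \<epsilon>) \<and>
     (\<forall>x. x \<notin> L \<longrightarrow> (\<forall>y \<in> certificates V. reject_prob V x y \<ge> 1 - \<epsilon>))"

text \<open>
  The resource bounds are worst-case: they range over all inputs, all certificates (also
  dishonest ones) and all coin outcomes.
\<close>

definition cons_space :: "'a verifier \<Rightarrow> bool" where
  "cons_space V \<longleftrightarrow>
     (\<exists>k. \<forall>x. \<forall>y \<in> certificates V. \<forall>\<omega>.
        finite (range (\<lambda>t. work_pos (run V x y \<omega> t))) \<and>
        card (range (\<lambda>t. work_pos (run V x y \<omega> t))) \<le> k)"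

definition cons_random_bits :: "'a verifier \<Rightarrow> bool" where
  "cons_random_bits V \<longleftrightarrow>
     (\<exists>k. \<forall>x. \<forall>y \<in> certificates V. \<forall>\<omega> t. tosses (run V x y \<omega> t) \<le> k)"

definition rt_input :: "'a verifier \<Rightarrow> bool" where
  "rt_input V \<longleftrightarrow>
     (\<forall>x. \<forall>y \<in> certificates V. \<forall>\<omega> t.
        state (run V x y \<omega> t) \<notin> halting_states V \<longrightarrow>
        input_pos (run V x y \<omega> (Suc t)) = input_pos (run V x y \<omega> t) + 1)"

definition oneway_IP :: "('a::finite verifier \<Rightarrow> bool) set \<Rightarrow> 'a list set set" where
  "oneway_IP R =
     {L. \<exists>V \<epsilon>. verifier V \<and> (\<forall>P \<in> R. P V) \<and> \<epsilon> < 1/2 \<and> oneway_proof_system V \<epsilon> L}"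

datatype letter = letter_a | letter_b | letter_c

instance letter :: finite
proof
  have "x \<in> {letter_a, letter_b, letter_c}" for x
    by (cases x) auto
  then show "finite (UNIV :: letter set)"
    by (intro finite_subset[of UNIV "{letter_a, letter_b, letter_c}"]) auto
qed

definition TWIN :: "letter list set" where
  "TWIN = {w @ [letter_c] @ w | w. set w \<subseteq> {letter_a, letter_b}}"

end

theory Submission
  imports Defs
begin

text \<open>
  The certificate spells \<open>wc\<close>. A first coin decides whether the verifier compares it with the
  input up to the first \<open>c\<close>, or with the input after that \<open>c\<close> (the right end-marker playing the
  part of the final \<open>c\<close>); in the latter case it also checks that no second \<open>c\<close> occurs. Outside
  the language no certificate survives both comparisons, so rejection has probability \<open>1/2\<close>,
  which is just not enough. To rebalance, two further coins make the verifier reject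
  unconditionally with probability \<open>1/4\<close>, whatever the comparison says: members are then accepted
  with probability \<open>3/4\<close>, and nonmembers rejected with probability at least
  \<open>1/4 + 3/4 * 1/2 = 5/8\<close>. The head never waits, so the three coins are tossed while it scans
  positions \<open>0\<close>, \<open>1\<close> and \<open>2\<close>; an input too short for this is empty and is rejected anyway.
\<close>

section \<open>The verifier\<close>

text \<open>
  \<open>Active bs seen\<close> stores the outcomes of the coins tossed so far, and whether a \<open>c\<close> has been read.
\<close>

datatype control = Accept | Reject | Active "bool list" bool

instance control :: countable
  by countable_datatype

fun code :: "letter \<Rightarrow> nat" where
  "code letter_a = 0"
| "code letter_b = 1"
| "code letter_c = 2"

lemma code_eq_iff [simp]: "code l = code l' \<longleftrightarrow> l = l'"
  by (cases l; cases l') auto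

declare code.simps [simp del]

fun record_toss :: "bool list \<Rightarrow> bool option \<Rightarrow> bool list" where
  "record_toss bs None = bs"
| "record_toss bs (Some b) = bs @ [b]"

text \<open>\<open>hd bs\<close> is the coin tossed at the left end-marker, hence present when a
  letter is read. In left mode the input \<open>c\<close> is itself compared with the certificate,
  which fixes where the certified word ends. At the right end-marker \<open>bs'\<close> replaces
  \<open>bs\<close> because on the one-letter input \<open>c\<close> the third coin falls in that
  very step; on the empty input \<open>bs' ! 2\<close> is unspecified, but \<open>seen\<close> is
  then false.\<close>

fun control_step ::
    "control \<Rightarrow> letter tape_symbol \<Rightarrow> nat \<Rightarrow> bool option \<Rightarrow> control \<times> bool" where
  "control_step (Active bs seen) Left_End m r = (Active (record_toss bs r) seen, False)"
| "control_step (Active bs seen) (Letter l) m r =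
     (let next_control = Active (record_toss bs r) (seen \<or> l = letter_c) in
      if hd bs then
        if seen then (next_control, False)
        else if m = code l then (next_control, True)
        else (Reject, False)
      else
        if \<not> seen then (next_control, False)
        else if m = code l \<and> l \<noteq> letter_c then (next_control, True)
        else (Reject, False))"
| "control_step (Active bs seen) Right_End m r =
     (let bs' = record_toss bs r in
      (if seen \<and> (hd bs \<or> m = code letter_c) \<and> \<not> (bs' ! 1 \<and> bs' ! 2) then Accept else Reject,
       False))"
| "control_step _ _ _ _ = (Reject, False)"

text \<open>States must be natural numbers, so controls are coded by \<open>to_nat\<close>. Tossing
  exactly while fewer than three outcomes are stored keeps the state set finite and bounds the
  coins.\<close>

definition twin_verifier :: "letter verifier" where
  "twin_verifier =
     \<lparr>states = to_nat ` ({Accept, Reject} \<union> {Active bs seen | bs seen. length bs \<le> 3}),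
      tossing_states = to_nat ` {Active bs seen | bs seen. length bs < 3},
      start_state = to_nat (Active [] False),
      accept_state = to_nat Accept,
      reject_state = to_nat Reject,
      work_alphabet = {0},
      blank_symbol = 0,
      cert_alphabet = range code,
      transition = (\<lambda>q s u m r. case control_step (from_nat q) s m r of
        (q', adv) \<Rightarrow> (to_nat q', 0, Rightwards, Stay, adv))\<rparr>"

lemma twin_verifier_simps:
  "accept_state twin_verifier = to_nat Accept" "reject_state twin_verifier = to_nat Reject"
  "transition twin_verifier q s u m r =
     (case control_step (from_nat q) s m r of (q', adv) \<Rightarrow> (to_nat q', 0, Rightwards, Stay, adv))"
  by (simp_all add: twin_verifier_def)

lemma to_nat_in_tossing_states [simp]:
  "to_nat q \<in> tossing_states twin_verifier \<longleftrightarrow> (\<exists>bs seen. q = Active bs seen \<and> length bs < 3)"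
  by (auto simp: twin_verifier_def image_iff)

lemma to_nat_in_halting_states [simp]:
  "to_nat q \<in> halting_states twin_verifier \<longleftrightarrow> q = Accept \<or> q = Reject"
  by (auto simp: twin_verifier_def halting_states_def)

lemma finite_active_controls: "finite {Active bs seen | bs seen. length bs \<le> n}"
proof -
  have "{Active bs seen | bs seen. length bs \<le> n}
      = (\<lambda>(bs, seen). Active bs seen) ` ({bs. length bs \<le> n} \<times> UNIV)"
    by auto
  moreover have "finite {bs :: bool list. length bs \<le> n}"
    using finite_lists_length_le[of "UNIV :: bool set" n] by simp
  ultimately show ?thesis
    by simp
qed

lemma control_step_Active:
  assumes "control_step (Active bs seen) s m r = (q, adv)"
  shows "q \<in> {Accept, Reject} \<or> (\<exists>seen'. q = Active (record_toss bs r) seen')"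
  using assms by (cases s) (auto simp: Let_def split: if_splits)

text \<open>The head always moves right, so it leaves the right end-marker; this is legal only in a
  halting step.\<close>

lemma control_step_Right_End:
  assumes "control_step q Right_End m r = (q', adv)"
  shows "q' \<in> {Accept, Reject}"
  using assms by (cases q) (auto simp: Let_def split: if_splits)

lemma verifier_twin_verifier: "verifier twin_verifier"
proof -
  let ?V = twin_verifier
  have step: "case transition ?V q s u m r of (q', u', d, e, adv) \<Rightarrow>
      q' \<in> states ?V \<and> u' \<in> work_alphabet ?V \<and> (s = Left_End \<longrightarrow> d \<noteq> Leftwards) \<and>
      (s = Right_End \<and> d = Rightwards \<longrightarrow> q' \<in> halting_states ?V)"
    if q: "q \<in> states ?V - halting_states ?V" and r: "r \<noteq> None \<longleftrightarrow> q \<in> tossing_states ?V"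
    for q s u m r
  proof -
    from q obtain bs seen where bs: "q = to_nat (Active bs seen)" "length bs \<le> 3"
      by (auto simp: twin_verifier_def halting_states_def)
    obtain q' adv where q': "control_step (Active bs seen) s m r = (q', adv)"
      by (rule prod.exhaust)
    have "length (record_toss bs r) \<le> 3"
      using r bs by (cases r) auto
    with control_step_Active[OF q'] have "to_nat q' \<in> states ?V"
      by (auto simp: twin_verifier_def)
    moreover have "s = Right_End \<Longrightarrow> to_nat q' \<in> halting_states ?V"
      using control_step_Right_End[of "Active bs seen" m r q' adv] q' by auto
    ultimately show ?thesis
      using bs q' by (simp add: twin_verifier_def)
  qed
  have "finite (states ?V)" "finite (work_alphabet ?V)" "finite (cert_alphabet ?V)"
    using finite_active_controls[of 3] by (simp_all add: twin_verifier_def)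
  moreover have "start_state ?V \<in> states ?V" "accept_state ?V \<in> states ?V"
      "reject_state ?V \<in> states ?V" "accept_state ?V \<noteq> reject_state ?V"
      "blank_symbol ?V \<in> work_alphabet ?V" "cert_alphabet ?V \<noteq> {}"
    by (auto simp: twin_verifier_def intro!: imageI)
  moreover have "tossing_states ?V \<subseteq> states ?V - halting_states ?V"
    by (auto simp: twin_verifier_def halting_states_def)
  ultimately show ?thesis
    unfolding verifier_def by (intro conjI ballI allI impI step)
qed

lemma step_halted: "state c \<in> halting_states V \<Longrightarrow> step V x y \<omega> c = c"
  by (simp add: step_def)

lemma step_Active:
  assumes "state c = to_nat (Active bs seen)"
    and "control_step (Active bs seen) (scanned_input x (input_pos c)) (y (cert_pos c))
          (if length bs < 3 then Some (\<omega> (tosses c)) else None) = (q, adv)"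
  shows "state (step twin_verifier x y \<omega> c) = to_nat q"
    and "input_pos (step twin_verifier x y \<omega> c) = input_pos c + 1"
    and "cert_pos (step twin_verifier x y \<omega> c) = (if adv then Suc (cert_pos c) else cert_pos c)"
    and "tosses (step twin_verifier x y \<omega> c) =
          (if length bs < 3 then Suc (tosses c) else tosses c)"
  using assms by (simp_all add: step_def Let_def twin_verifier_simps)

section \<open>Resource bounds\<close>

lemma run_Suc: "run V x y \<omega> (Suc t) = step V x y \<omega> (run V x y \<omega> t)"
  by (simp add: run_def)

lemma rt_input_twin_verifier: "rt_input twin_verifier"
  by (auto simp: rt_input_def run_Suc step_def Let_def twin_verifier_simps split: prod.splits)

lemma work_pos_run: "work_pos (run twin_verifier x y \<omega> t) = 0"
proof (induction t)
  case 0
  then show ?case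
    by (simp add: run_def init_config_def)
next
  case (Suc t)
  then show ?case
    by (auto simp: run_Suc step_def Let_def twin_verifier_simps split: prod.splits)
qed

lemma cons_space_twin_verifier: "cons_space twin_verifier"
  unfolding cons_space_def by (rule exI[of _ 1]) (simp add: work_pos_run)

text \<open>The stored list is a toss counter, and a full list tosses no more. The bound 3 is
  carried separately because halting controls store no list.\<close>

lemma tosses_run:
  "\<exists>q. state (run twin_verifier x y \<omega> t) = to_nat q \<and> tosses (run twin_verifier x y \<omega> t) \<le> 3 \<and>
     (\<forall>bs seen. q = Active bs seen \<longrightarrow> length bs = tosses (run twin_verifier x y \<omega> t))"
proof (induction t)
  case 0
  show ?case
    by (auto simp: run_def init_config_def twin_verifier_def)
next
  case (Suc t)
  let ?c = "run twin_verifier x y \<omega> t"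
  from Suc obtain q where q: "state ?c = to_nat q" "tosses ?c \<le> 3"
    "\<And>bs seen. q = Active bs seen \<Longrightarrow> length bs = tosses ?c"
    by blast
  show ?case
  proof (cases "q = Accept \<or> q = Reject")
    case True
    then show ?thesis
      using q by (auto simp: run_Suc step_halted)
  next
    case False
    then obtain bs seen where bs: "q = Active bs seen"
      by (cases q) auto
    let ?r = "if length bs < 3 then Some (\<omega> (tosses ?c)) else None"
    obtain q' adv where q':
      "control_step (Active bs seen) (scanned_input x (input_pos ?c)) (y (cert_pos ?c)) ?r
        = (q', adv)"
      by (rule prod.exhaust)
    note step = step_Active[OF q(1)[unfolded bs], of x y \<omega>, OF q']
    show ?thesis
      using control_step_Active[OF q'] step(1,4) q(2) q(3)[OF bs]
      by (auto simp: run_Suc)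
  qed
qed

lemma cons_random_bits_twin_verifier: "cons_random_bits twin_verifier"
  unfolding cons_random_bits_def using tosses_run by blast

section \<open>The outcome of a computation\<close>

fun spells :: "(nat \<Rightarrow> nat) \<Rightarrow> nat \<Rightarrow> letter list \<Rightarrow> bool" where
  "spells y k [] \<longleftrightarrow> True"
| "spells y k (l # xs) \<longleftrightarrow> y k = code l \<and> spells y (Suc k) xs"

abbreviation before_c :: "letter list \<Rightarrow> letter list" where
  "before_c xs \<equiv> takeWhile (\<lambda>l. l \<noteq> letter_c) xs"

abbreviation after_c :: "letter list \<Rightarrow> letter list" where
  "after_c xs \<equiv> tl (dropWhile (\<lambda>l. l \<noteq> letter_c) xs)"

text \<open>This is what remains to be verified in left mode with \<open>xs\<close> unread and the
  certificate head at \<open>k\<close>. A mismatch rejects at once, so surviving past the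
  \<open>c\<close> means success.\<close>

definition check_left :: "(nat \<Rightarrow> nat) \<Rightarrow> nat \<Rightarrow> bool \<Rightarrow> letter list \<Rightarrow> bool" where
  "check_left y k seen xs \<longleftrightarrow>
     seen \<or> letter_c \<in> set xs \<and> spells y k (before_c xs @ [letter_c])"

text \<open>The certificate head waits until the \<open>c\<close> is passed, so \<open>k\<close> is
  the right starting cell in both cases. The \<open>c\<close> appended to \<open>v\<close> is
  matched by the right end-marker.\<close>

definition check_right :: "(nat \<Rightarrow> nat) \<Rightarrow> nat \<Rightarrow> bool \<Rightarrow> letter list \<Rightarrow> bool" where
  "check_right y k seen xs \<longleftrightarrow>
     (let v = (if seen then xs else after_c xs)
      in (seen \<or> letter_c \<in> set xs) \<and> letter_c \<notin> set v \<and> spells y k (v @ [letter_c]))"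

text \<open>The outcome of the remaining computation, as a function of the whole coin sequence,
  including coins not yet tossed.\<close>

definition verdict ::
    "(nat \<Rightarrow> nat) \<Rightarrow> (nat \<Rightarrow> bool) \<Rightarrow> nat \<Rightarrow> bool \<Rightarrow> letter list \<Rightarrow> control" where
  "verdict y \<omega> k seen xs =
     (if (if \<omega> 0 then check_left y k seen xs else check_right y k seen xs) \<and> \<not> (\<omega> 1 \<and> \<omega> 2)
      then Accept else Reject)"

text \<open>The verdict is invariant under reading a letter: either a mismatch settles it as
  rejection, or it passes to the unread tail with the updated certificate position.\<close>

lemma verdict_Cons:
  assumes "control_step (Active bs seen) (Letter l) (y k) r = (q, adv)" and "hd bs = \<omega> 0"
  shows "q = Reject \<and> verdict y \<omega> k seen (l # xs) = Reject
    \<or> q = Active (record_toss bs r) (seen \<or> l = letter_c) \<and> verdict y \<omega> k seen (l # xs)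
        = verdict y \<omega> (if adv then Suc k else k) (seen \<or> l = letter_c) xs"
proof (cases "\<omega> 0")
  case True
  then show ?thesis
    using assms
    by (cases seen; cases "l = letter_c"; cases "y k = code l")
      (auto simp: verdict_def check_left_def)
next
  case False
  then show ?thesis
    using assms
    by (cases seen; cases "l = letter_c"; cases "y k = code l")
      (auto simp: verdict_def check_right_def)
qed

lemma record_toss_upt:
  "record_toss (map \<omega> [0..<min 3 n]) (if n < 3 then Some (\<omega> n) else None)
     = map \<omega> [0..<min 3 (Suc n)]"
  by (cases "n = 2") (auto simp: min_def eval_nat_numeral)

text \<open>Induction on the unread suffix \<open>xs\<close>. After \<open>i\<close> letters the
  head is at position \<open>i + 1\<close>, and one coin was tossed at each earlier position until
  three were reached.\<close>

lemma verdict_reached: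
  assumes "state c = to_nat (Active (map \<omega> [0..<min 3 (Suc i)]) seen)"
    and "tosses c = min 3 (Suc i)" and "input_pos c = int (Suc i)"
    and "drop i x = xs" and "i \<le> length x" and "seen \<Longrightarrow> i > 0"
  shows "\<exists>t. state ((step twin_verifier x y \<omega> ^^ t) c) = to_nat (verdict y \<omega> (cert_pos c) seen xs)"
  using assms
proof (induction xs arbitrary: c i seen)
  case Nil
  let ?bs = "map \<omega> [0..<min 3 (Suc i)]"
  let ?r = "if length ?bs < 3 then Some (\<omega> (tosses c)) else None"
  have "i = length x"
    using Nil.prems by simp
  then have scanned: "scanned_input x (input_pos c) = Right_End"
    using Nil.prems by (simp add: scanned_input_def)
  have "record_toss ?bs ?r = map \<omega> [0..<min 3 (Suc (Suc i))]"
    using record_toss_upt[of \<omega> "Suc i"] Nil.prems(2) by (simp split: if_splits)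
  moreover have "hd ?bs = \<omega> 0"
    by (simp add: hd_map upt_rec)
  \<comment> \<open>A seen \<open>c\<close> forces \<open>i > 0\<close>, so with the coin of the
    present step all three are stored and the two veto coins can be looked up.\<close>
  moreover have late: "map \<omega> [0..<min 3 (Suc (Suc i))] ! 1 = \<omega> 1 \<and>
      map \<omega> [0..<min 3 (Suc (Suc i))] ! 2 = \<omega> 2" if seen
    using Nil.prems(6)[OF that] by (auto simp: min_def nth_append eval_nat_numeral)
  ultimately have
    "control_step (Active ?bs seen) (scanned_input x (input_pos c)) (y (cert_pos c)) ?r
       = (verdict y \<omega> (cert_pos c) seen [], False)"
    using late unfolding scanned
    by (simp add: verdict_def check_left_def check_right_def Let_def)
  from step_Active(1)[OF Nil.prems(1), of x y \<omega>, OF this] show ?case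
    by (intro exI[of _ 1]) simp
next
  case (Cons l xs)
  let ?bs = "map \<omega> [0..<min 3 (Suc i)]"
  let ?bs' = "map \<omega> [0..<min 3 (Suc (Suc i))]"
  let ?r = "if length ?bs < 3 then Some (\<omega> (tosses c)) else None"
  let ?c' = "step twin_verifier x y \<omega> c"
  have "i < length x"
    using Cons.prems(4) by (cases "i < length x") auto
  then have i: "i < length x" "x ! i = l" "drop (Suc i) x = xs"
    using Cons.prems(4) by (auto simp: Cons_nth_drop_Suc[symmetric])
  then have scanned: "scanned_input x (input_pos c) = Letter l"
    using Cons.prems by (simp add: scanned_input_def)
  have rec: "record_toss ?bs ?r = ?bs'"
    using record_toss_upt[of \<omega> "Suc i"] Cons.prems(2) by (simp split: if_splits)
  have hd: "hd ?bs = \<omega> 0"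
    by (simp add: hd_map upt_rec)
  obtain q adv where q:
    "control_step (Active ?bs seen) (scanned_input x (input_pos c)) (y (cert_pos c)) ?r = (q, adv)"
    by (rule prod.exhaust)
  note step = step_Active[OF Cons.prems(1), of x y \<omega>, OF q]
  have "q = Reject \<and> verdict y \<omega> (cert_pos c) seen (l # xs) = Reject
      \<or> q = Active ?bs' (seen \<or> l = letter_c) \<and> verdict y \<omega> (cert_pos c) seen (l # xs)
          = verdict y \<omega> (cert_pos ?c') (seen \<or> l = letter_c) xs"
    using verdict_Cons[of ?bs seen l y "cert_pos c" ?r q adv \<omega> xs, OF q[unfolded scanned] hd]
    unfolding rec step(3) .
  then show ?case
  proof (elim disjE conjE, goal_cases)
    case 1
    then show ?thesis
      using step(1) by (intro exI[of _ 1]) simp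
  next
    case 2
    have "\<exists>t. state ((step twin_verifier x y \<omega> ^^ t) ?c')
        = to_nat (verdict y \<omega> (cert_pos ?c') (seen \<or> l = letter_c) xs)"
      using Cons.prems(2,3) i step(1,2,4) 2(1) by (intro Cons.IH[of _ "Suc i"]) auto
    then obtain t where "state ((step twin_verifier x y \<omega> ^^ Suc t) c)
        = to_nat (verdict y \<omega> (cert_pos c) seen (l # xs))"
      using 2(2) by (auto simp: funpow_swap1)
    then show ?thesis ..
  qed
qed

lemma run_reaches_verdict:
  "\<exists>t. state (run twin_verifier x y \<omega> t) = to_nat (verdict y \<omega> 0 False x)"
proof -
  let ?c = "init_config twin_verifier"
  let ?c' = "step twin_verifier x y \<omega> ?c"
  have "state ?c = to_nat (Active [] False)"
    by (simp add: init_config_def twin_verifier_def)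
  from step_Active[OF this, of x y \<omega> "Active [\<omega> 0] False" False]
  have "state ?c' = to_nat (Active [\<omega> 0] False)" "input_pos ?c' = 1" "cert_pos ?c' = 0"
    "tosses ?c' = 1"
    by (simp_all add: init_config_def scanned_input_def)
  then have "\<exists>t. state ((step twin_verifier x y \<omega> ^^ t) ?c') = to_nat (verdict y \<omega> 0 False x)"
    using verdict_reached[of ?c' \<omega> 0 False x x y] by simp
  then obtain t where
    "state (run twin_verifier x y \<omega> (Suc t)) = to_nat (verdict y \<omega> 0 False x)"
    unfolding run_def by (auto simp: funpow_swap1)
  then show ?thesis ..
qed

lemma run_halted:
  assumes "state (run V x y \<omega> t) \<in> halting_states V" and "t \<le> t'"
  shows "run V x y \<omega> t' = run V x y \<omega> t"
  using assms(2,1) by (induction rule: dec_induct) (simp_all add: run_Suc step_halted)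

text \<open>Reduces the time-quantified event to a condition on \<open>\<omega>\<close> alone, whose
  probability can be computed.\<close>

lemma halts_in_iff:
  assumes "q = Accept \<or> q = Reject"
  shows "(\<exists>t. state (run twin_verifier x y \<omega> t) = to_nat q) \<longleftrightarrow> verdict y \<omega> 0 False x = q"
proof
  assume "\<exists>t. state (run twin_verifier x y \<omega> t) = to_nat q"
  then obtain t where t: "state (run twin_verifier x y \<omega> t) = to_nat q" ..
  obtain t' where t': "state (run twin_verifier x y \<omega> t') = to_nat (verdict y \<omega> 0 False x)"
    using run_reaches_verdict by blast
  \<comment> \<open>Halted configurations are frozen, so two halting times can be compared at their
    maximum.\<close>
  have "run twin_verifier x y \<omega> (max t t') = run twin_verifier x y \<omega> t"
    by (rule run_halted) (use t assms in auto)
  moreover have "run twin_verifier x y \<omega> (max t t') = run twin_verifier x y \<omega> t'"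
    by (rule run_halted) (auto simp: t' verdict_def)
  ultimately have "to_nat q = to_nat (verdict y \<omega> 0 False x)"
    using t t' by simp
  then show "verdict y \<omega> 0 False x = q"
    by simp
next
  assume "verdict y \<omega> 0 False x = q"
  then show "\<exists>t. state (run twin_verifier x y \<omega> t) = to_nat q"
    using run_reaches_verdict by blast
qed

section \<open>Correctness of the comparisons\<close>

text \<open>The letter \<open>c\<close> acts as terminator: each word is what the certificate spells
  from \<open>k\<close> up to its first \<open>c\<close>.\<close>

lemma spells_unique:
  assumes "spells y k (v @ [letter_c])" and "spells y k (w @ [letter_c])"
    and "letter_c \<notin> set v" and "letter_c \<notin> set w"
  shows "v = w"
  using assms
proof (induction v arbitrary: w k)
  case Nil
  then show ?case
    by (cases w) auto
next
  case (Cons l v)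
  then show ?case
    by (cases w) auto
qed

lemma spells_nth: "(\<And>i. i < length xs \<Longrightarrow> y (k + i) = code (xs ! i)) \<Longrightarrow> spells y k xs"
proof (induction xs arbitrary: k)
  case (Cons l xs)
  have "y (Suc k + i) = code (xs ! i)" if "i < length xs" for i
    using Cons.prems[of "Suc i"] that by simp
  then show ?case
    using Cons.IH Cons.prems[of 0] by simp
qed simp

text \<open>Soundness: both comparisons read the same certificate from the same cell, so the parts
  on either side of the first \<open>c\<close> equal one common word.\<close>

lemma checks_imp_TWIN:
  assumes "check_left y k False x" and "check_right y k False x"
  shows "x \<in> TWIN"
proof -
  let ?w = "before_c x" and ?v = "after_c x"
  from assms have c: "letter_c \<in> set x" "letter_c \<notin> set ?v"
    and "spells y k (?w @ [letter_c])" "spells y k (?v @ [letter_c])"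
    by (auto simp: check_left_def check_right_def Let_def)
  moreover have w: "letter_c \<notin> set ?w"
    by (auto dest: set_takeWhileD)
  ultimately have "?w = ?v"
    using spells_unique by blast
  moreover have "x = ?w @ letter_c # ?v"
    using c(1) by (induction x) auto
  moreover have "set ?w \<subseteq> {letter_a, letter_b}"
  proof
    fix l
    assume "l \<in> set ?w"
    with w show "l \<in> {letter_a, letter_b}"
      by (cases l) auto
  qed
  ultimately show ?thesis
    unfolding TWIN_def by force
qed

lemma TWIN_imp_checks:
  assumes "x \<in> TWIN"
  shows "\<exists>y \<in> certificates twin_verifier. check_left y 0 False x \<and> check_right y 0 False x"
proof -
  from assms obtain w where x: "x = w @ [letter_c] @ w" and w: "set w \<subseteq> {letter_a, letter_b}"
    by (auto simp: TWIN_def)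
  \<comment> \<open>The honest certificate is \<open>w\<close> followed by \<open>c\<close> forever;
    only the first of these \<open>c\<close> is ever compared, the rest make the sequence
    infinite.\<close>
  define y where "y i = code (if i < length w then w ! i else letter_c)" for i
  have "spells y 0 (w @ [letter_c])"
    by (rule spells_nth) (auto simp: y_def nth_append)
  moreover have "letter_c \<notin> set w"
    using w by auto
  moreover from this have "before_c x = w" "after_c x = w"
    unfolding x by (induction w rule: rev_induct) (auto simp: takeWhile_append dropWhile_append)
  ultimately have "check_left y 0 False x" "check_right y 0 False x"
    by (auto simp: check_left_def check_right_def x)
  moreover have "y \<in> certificates twin_verifier"
    by (auto simp: certificates_def twin_verifier_def y_def)
  ultimately show ?thesis
    by blast
qed

section \<open>Acceptance and rejection probabilities\<close>

interpretation coin: prob_space coin_measure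
  unfolding coin_measure_def by (intro prob_space_PiM measure_pmf.prob_space_axioms)

lemma space_coin_measure [simp]: "space coin_measure = UNIV"
  by (simp add: coin_measure_def space_PiM)

text \<open>Fixing finitely many coins is a cylinder over singletons, so its measure is a product of
  factors 1/2.\<close>

lemma coin_cylinder:
  assumes "finite J"
  shows "{\<omega>. \<forall>j\<in>J. \<omega> j = f j} \<in> sets coin_measure"
    and "coin.prob {\<omega>. \<forall>j\<in>J. \<omega> j = f j} = (1/2) ^ card J"
proof -
  interpret product_prob_space "\<lambda>_. measure_pmf (bernoulli_pmf (1/2))" "UNIV :: nat set"
    by (rule product_prob_spaceI) (rule measure_pmf.prob_space_axioms)
  have emb: "{\<omega>. \<forall>j\<in>J. \<omega> j = f j}
      = prod_emb UNIV (\<lambda>_. measure_pmf (bernoulli_pmf (1/2))) J (\<Pi>\<^sub>E j\<in>J. {f j})"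
    by (rule set_eqI) (simp add: prod_emb_iff restrict_PiE_iff Pi_iff)
  show "{\<omega>. \<forall>j\<in>J. \<omega> j = f j} \<in> sets coin_measure"
    unfolding emb coin_measure_def using assms by (intro sets_PiM_I) auto
  have "coin.prob {\<omega>. \<forall>j\<in>J. \<omega> j = f j}
      = (\<Prod>j\<in>J. measure (measure_pmf (bernoulli_pmf (1/2))) {f j})"
    unfolding emb coin_measure_def using assms by (intro measure_PiM_emb) auto
  also have "\<dots> = (\<Prod>j\<in>J. 1/2)"
    by (intro prod.cong refl) (simp add: measure_pmf_single)
  finally show "coin.prob {\<omega>. \<forall>j\<in>J. \<omega> j = f j} = (1/2) ^ card J"
    by simp
qed

lemma coin_events:
  shows "{\<omega>. \<omega> 1 \<and> \<omega> 2} \<in> coin.events" and "coin.prob {\<omega>. \<omega> 1 \<and> \<omega> 2} = 1/4"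
    and "{\<omega>. \<omega> 0 = b} \<in> coin.events" and "coin.prob {\<omega>. \<omega> 0 = b} = 1/2"
    and "coin.prob ({\<omega>. \<omega> 1 \<and> \<omega> 2} \<inter> {\<omega>. \<omega> 0 = b}) = 1/8"
proof -
  have "{\<omega>. \<omega> 1 \<and> \<omega> 2} = {\<omega>. \<forall>j\<in>{1,2::nat}. \<omega> j = True}"
    by auto
  then show "{\<omega>. \<omega> 1 \<and> \<omega> 2} \<in> coin.events" "coin.prob {\<omega>. \<omega> 1 \<and> \<omega> 2} = 1/4"
    using coin_cylinder[of "{1,2}" "\<lambda>_. True"] by (simp_all add: power2_eq_square)
  have "{\<omega>. \<omega> 0 = b} = {\<omega>. \<forall>j\<in>{0::nat}. \<omega> j = b}"
    by auto
  then show "{\<omega>. \<omega> 0 = b} \<in> coin.events" "coin.prob {\<omega>. \<omega> 0 = b} = 1/2"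
    using coin_cylinder[of "{0}" "\<lambda>_. b"] by simp_all
  have "{\<omega>. \<omega> 1 \<and> \<omega> 2} \<inter> {\<omega>. \<omega> 0 = b}
      = {\<omega>. \<forall>j\<in>{0,1,2::nat}. \<omega> j = (if j = 0 then b else True)}"
    by auto
  then show "coin.prob ({\<omega>. \<omega> 1 \<and> \<omega> 2} \<inter> {\<omega>. \<omega> 0 = b}) = 1/8"
    using coin_cylinder(2)[of "{0,1,2}" "\<lambda>j. if j = 0 then b else True"]
    by (simp add: power3_eq_cube)
qed

lemma accept_prob_twin_verifier:
  assumes "check_left y 0 False x" and "check_right y 0 False x"
  shows "accept_prob twin_verifier x y = 3/4"
proof -
  have "{\<omega>. \<exists>t. state (run twin_verifier x y \<omega> t) = accept_state twin_verifier}
      = UNIV - {\<omega>. \<omega> 1 \<and> \<omega> 2}"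
    using assms halts_in_iff[of Accept x y]
    by (auto simp: twin_verifier_simps verdict_def)
  then show ?thesis
    using coin_events(1,2) coin.prob_compl[OF coin_events(1)] by (simp add: accept_prob_def)
qed

lemma reject_prob_twin_verifier:
  assumes "\<not> (check_left y 0 False x \<and> check_right y 0 False x)"
  shows "reject_prob twin_verifier x y \<ge> 5/8"
proof -
  let ?R = "{\<omega>. \<exists>t. state (run twin_verifier x y \<omega> t) = reject_state twin_verifier}"
  let ?E = "{\<omega> :: nat \<Rightarrow> bool. \<omega> 1 \<and> \<omega> 2}"
  \<comment> \<open>\<open>b\<close> is a value of the first coin that selects a failing
    comparison.\<close>
  obtain b where b: "\<not> (if b then check_left y 0 False x else check_right y 0 False x)"
    using assms by (metis (full_types))
  let ?F = "{\<omega> :: nat \<Rightarrow> bool. \<omega> 0 = b}"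
  have R: "?R = {\<omega>. verdict y \<omega> 0 False x = Reject}"
    using halts_in_iff[of Reject x y]
    by (auto simp: twin_verifier_simps)
  \<comment> \<open>Inclusion-exclusion: 1/4 + 1/2 - 1/8.\<close>
  have "coin.prob (?E \<union> ?F) = 5/8"
    using coin_events(1,2) coin_events(3-5)[of b] by (simp add: coin.finite_measure_Union' coin.finite_measure_Diff' Int_commute)
  moreover have "?E \<union> ?F \<subseteq> ?R"
    unfolding R using b by (auto simp: verdict_def)
  \<comment> \<open>Monotonicity of the measure needs the larger set to be measurable. For fixed
    \<open>x\<close> and \<open>y\<close> the checks are constants, so \<open>?R\<close> is built
    from coin events.\<close>
  moreover have "?R \<in> coin.events"
  proof -
    have "?R = ?E \<union> ({\<omega>. \<omega> 0 = True} \<inter> (if check_left y 0 False x then {} else UNIV))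
        \<union> ({\<omega>. \<omega> 0 = False} \<inter> (if check_right y 0 False x then {} else UNIV))"
      unfolding R by (auto simp: verdict_def)
    then show ?thesis
      using coin_events(1) coin_events(3)[of True] coin_events(3)[of False]
      by auto
  qed
  ultimately have "5/8 \<le> coin.prob ?R"
    using coin.finite_measure_mono[of "?E \<union> ?F" ?R] by linarith
  then show ?thesis
    by (simp add: reject_prob_def)
qed

theorem theorem5: "TWIN \<in> oneway_IP {cons_space, cons_random_bits, rt_input}"
proof -
  \<comment> \<open>The error 3/8 is dictated by the rejection bound 5/8; acceptance with
    probability 3/4 leaves room to spare.\<close>
  have "oneway_proof_system twin_verifier (3/8) TWIN"
    unfolding oneway_proof_system_def
  proof (intro conjI ballI allI impI)
    fix x :: "letter list"
    assume "x \<in> TWIN"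
    then show "\<exists>y\<in>certificates twin_verifier. 1 - 3/8 \<le> accept_prob twin_verifier x y"
      using TWIN_imp_checks[of x] accept_prob_twin_verifier[of _ x] by force
  next
    fix x :: "letter list" and y :: "nat \<Rightarrow> nat"
    assume "x \<notin> TWIN"
    then show "1 - 3/8 \<le> reject_prob twin_verifier x y"
      using checks_imp_TWIN reject_prob_twin_verifier[of y x] by auto
  qed
  then show ?thesis
    unfolding oneway_IP_def
    using verifier_twin_verifier cons_space_twin_verifier cons_random_bits_twin_verifier
      rt_input_twin_verifier
    by (intro CollectI exI[of _ twin_verifier] exI[of _ "3/8"]) auto
qed

end
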